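(* For $p\in[1,\infty]$, in the matrix-vector model, a one-sided non-adaptive $(\epsilon,\ell_p)$-tester for real symmetric $d\times d$ matrices must make at least $\Omega\!\left(\frac{1}{\epsilon}d^{1-1/p}\right)$ queries.
   Context: For a real symmetric $d\times d$ matrix $A$, $\|A\|_p$ denotes the Schatten-$p$ norm (the $\ell_p$ norm of the vector of singular values; $\|A\|_\infty$ is the operator norm), and $\lambda_{\min}(A)$ is its smallest eigenvalue. PSD means positive semidefinite. The parameter $\epsilon$ satisfies $0<\epsilon<1$, and $1/p=0$ when $p=\infty$. In the matrix-vector model an algorithm accesses an unknown real symmetric $d\times d$ matrix $A$ through queries in which it chooses a vector $v\in\mathbb{R}^d$ and receives the vector $Av$; it is non-adaptive if the queries do not depend on the answers to other queries. For $p\in[1,\infty]$, an $(\epsilon,\ell_p)$-tester is a (randomized) algorithm that makes such queries to $A$, outputs True with probability at least $2/3$ if $A$ is PSD, and outputs False with probability at least $2/3$ if $A$ is $\epsilon\|A\|_p$-far in spectral distance from the PSD cone, or equivalently if $\lambda_{\min}(A)\le-\epsilon\|A\|_p$. The tester is one-sided (has one-sided error) if it is guaranteed to output True on all PSD inputs, even if the input is generated by an adversary with access to the random coins of the tester. $\Omega(\cdot)$ is the standard asymptotic notation.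
   Formalization: The bound is proved for δ·d^{-1/p} ≤ ε ≤ 1−δ, for every δ>0, with a constant depending only on δ; no single constant works for all d and 0<ε<1 (d queries always suffice). The zero matrix, which is both PSD and "far", need not be rejected. *)

theory Defs
  imports "HOL-Probability.Probability_Measure" "Jordan_Normal_Form.Spectral_Radius"
begin

text \<open>Vectors and matrices are those of \<^theory>\<open>Jordan_Normal_Form.Matrix\<close>, not those of
  \<^theory>\<open>HOL-Analysis.Finite_Cartesian_Product\<close>, since the dimension \<open>d\<close> is quantified inside the
  main statement.\<close>

definition real_symmetric :: "nat \<Rightarrow> real Matrix.mat \<Rightarrow> bool" where
  "real_symmetric d A \<longleftrightarrow> A \<in> carrier_mat d d \<and> transpose_mat A = A"

definition psd :: "nat \<Rightarrow> real Matrix.mat \<Rightarrow> bool" where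
  "psd d A \<longleftrightarrow> real_symmetric d A \<and> (\<forall>v\<in>carrier_vec d. 0 \<le> scalar_prod v (A *\<^sub>v v))"

definition lambda_min :: "real Matrix.mat \<Rightarrow> real" where
  "lambda_min A = Min (spectrum A)"

text \<open>All roots of the characteristic polynomial of \<open>A\<^sup>T A\<close> are real and non-negative, so the
  following multiset has as many elements as \<open>A\<close> has columns.\<close>

definition singular_values :: "real Matrix.mat \<Rightarrow> real multiset" where
  "singular_values A = image_mset sqrt (proots (char_poly (transpose_mat A * A)))"

definition schatten_norm :: "ereal \<Rightarrow> real Matrix.mat \<Rightarrow> real" where
  "schatten_norm p A =
     (if p = \<infinity> then Max (set_mset (singular_values A))
      else (\<Sum>s\<in>#singular_values A. s powr real_of_ereal p) powr (1 / real_of_ereal p))"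

text \<open>A non-adaptive algorithm whose random coins have been fixed consists of a list of query
  vectors, chosen before any answer is seen, and a rule that computes the output from the list of
  answers. A randomized non-adaptive algorithm is a probability measure on such pairs: every source
  of randomness \<open>\<omega>\<close> induces one by pushing forward along the map taking \<open>\<omega>\<close> to the pair it selects,
  and the \<open>\<sigma>\<close>-algebra is left arbitrary except that acceptance of each input has to be an event.\<close>

type_synonym nonadaptive_alg = "real Matrix.vec list \<times> (real Matrix.vec list \<Rightarrow> bool)"

definition accepts :: "nonadaptive_alg \<Rightarrow> real Matrix.mat \<Rightarrow> bool" where
  "accepts a A \<longleftrightarrow> snd a (map (\<lambda>v. A *\<^sub>v v) (fst a))"

definition randomized_alg :: "nat \<Rightarrow> nat \<Rightarrow> nonadaptive_alg measure \<Rightarrow> bool" where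
  "randomized_alg d q M \<longleftrightarrow>
     prob_space M \<and>
     (\<forall>a\<in>space M. set (fst a) \<subseteq> carrier_vec d \<and> length (fst a) \<le> q) \<and>
     (\<forall>A. real_symmetric d A \<longrightarrow> {a \<in> space M. accepts a A} \<in> sets M)"

text \<open>The zero matrix satisfies \<open>\<lambda>\<^sub>m\<^sub>i\<^sub>n \<le> - \<epsilon> \<parallel>A\<parallel>\<^sub>p\<close> with equality although it is PSD. It has to be
  excluded from the inputs to be rejected, for otherwise no tester would exist.\<close>

definition far_from_psd :: "nat \<Rightarrow> real \<Rightarrow> ereal \<Rightarrow> real Matrix.mat \<Rightarrow> bool" where
  "far_from_psd d \<epsilon> p A \<longleftrightarrow>
     real_symmetric d A \<and> A \<noteq> 0\<^sub>m d d \<and> lambda_min A \<le> - \<epsilon> * schatten_norm p A"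

definition psd_tester :: "nat \<Rightarrow> real \<Rightarrow> ereal \<Rightarrow> nat \<Rightarrow> nonadaptive_alg measure \<Rightarrow> bool" where
  "psd_tester d \<epsilon> p q M \<longleftrightarrow>
     randomized_alg d q M \<and>
     (\<forall>A. psd d A \<longrightarrow> measure M {a \<in> space M. accepts a A} \<ge> 2 / 3) \<and>
     (\<forall>A. far_from_psd d \<epsilon> p A \<longrightarrow> measure M {a \<in> space M. \<not> accepts a A} \<ge> 2 / 3)"

text \<open>The input may be chosen after the random coins are known, hence no probability here.\<close>

definition one_sided :: "nat \<Rightarrow> nonadaptive_alg measure \<Rightarrow> bool" where
  "one_sided d M \<longleftrightarrow> (\<forall>a\<in>space M. \<forall>A. psd d A \<longrightarrow> accepts a A)"

text \<open>On the range of \<open>\<epsilon>\<close> in a lower bound \<open>\<Omega>(d\<^sup>1\<^sup>-\<^sup>1\<^sup>/\<^sup>p / \<epsilon>)\<close>: no constant works for all \<open>d\<close> and all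
  \<open>0 < \<epsilon> < 1\<close> at once. Querying the \<open>d\<close> unit vectors reveals \<open>A\<close>, so the bound fails for \<open>\<epsilon>\<close> much
  smaller than \<open>d\<^sup>-\<^sup>1\<^sup>/\<^sup>p\<close>; and for \<open>1 < p < \<infinity>\<close> and \<open>\<epsilon>\<close> close to \<open>1\<close> (depending on \<open>d\<close>) an input to be
  rejected is nearly a negative rank-one matrix, which a constant number of random queries detects.
  The asymptotic bound is therefore uniform on each window \<open>\<delta> d\<^sup>-\<^sup>1\<^sup>/\<^sup>p \<le> \<epsilon> \<le> 1 - \<delta>\<close>. For fixed \<open>\<epsilon>\<close>
  and \<open>\<delta> = min \<epsilon> (1 - \<epsilon>)\<close> the window includes every \<open>d \<ge> 1\<close>.\<close>

end

theory Submission
  imports Defs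
begin

text \<open>The inputs \<open>A\<^sub>i = I - (1 + t) e\<^sub>i e\<^sub>i\<^sup>T\<close>, \<open>i < d\<close>, are far from PSD for
  \<open>t = \<epsilon> d\<^sup>1\<^sup>/\<^sup>p / \<delta>\<close>. Fix the coins, and let \<open>Q\<close> be the orthogonal projection onto the
  complement of the span of the \<open>q\<close> queries. If \<open>e\<^sub>i\<close> is close to that complement, namely
  \<open>(1 + t) (1 - Q\<^sub>i\<^sub>i) < 1\<close>, then \<open>A\<^sub>i\<close> plus a large multiple of \<open>(Q e\<^sub>i) (Q e\<^sub>i)\<^sup>T\<close> is PSD and answers
  every query as \<open>A\<^sub>i\<close> does, so a one-sided tester accepts \<open>A\<^sub>i\<close>. As \<open>\<Sum>\<^sub>i (1 - Q\<^sub>i\<^sub>i) \<le> q\<close>, at most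
  \<open>(1 + t) q\<close> of the \<open>A\<^sub>i\<close> are rejected, whereas on average the tester rejects at
  least \<open>2 d / 3\<close> of them.\<close>

section \<open>Projection away from the queries\<close>

text \<open>Gram-Schmidt, one vector at a time: start from the identity, and for each new vector
  remove from \<open>Q\<close> the direction of its projection. The last sum is the trace defect,
  that is, the dimension of the span, and each vector adds at most one to it.\<close>

lemma orthogonal_complement_projection:
  fixes vs :: "(nat \<Rightarrow> real) list"
  shows "\<exists>Q :: nat \<Rightarrow> nat \<Rightarrow> real.
    (\<forall>i j. Q i j = Q j i) \<and>
    (\<forall>i<d. \<forall>j<d. (\<Sum>k=0..<d. Q i k * Q k j) = Q i j) \<and>
    (\<forall>v\<in>set vs. \<forall>i<d. (\<Sum>j=0..<d. Q i j * v j) = 0) \<and>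
    (\<Sum>i=0..<d. 1 - Q i i) \<le> length vs"
proof (induction vs)
  case Nil
  have "(\<Sum>k=0..<d. (if i = k then 1 else 0) * (if k = j then 1 else 0)) = (if i = j then 1 else (0::real))"
    if "i < d" for i j
    using that by (subst sum.remove[of _ i]) (auto intro: sum.neutral)
  then show ?case
    by (intro exI[of _ "\<lambda>i j. if i = j then 1 else 0"]) auto
next
  case (Cons v vs)
  then obtain Q :: "nat \<Rightarrow> nat \<Rightarrow> real"
    where sym: "\<And>i j. Q i j = Q j i"
      and idem: "\<And>i j. i < d \<Longrightarrow> j < d \<Longrightarrow> (\<Sum>k=0..<d. Q i k * Q k j) = Q i j"
      and null: "\<And>w i. w \<in> set vs \<Longrightarrow> i < d \<Longrightarrow> (\<Sum>j=0..<d. Q i j * w j) = 0"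
      and tr: "(\<Sum>i=0..<d. 1 - Q i i) \<le> length vs"
    by blast
  \<comment> \<open>\<open>u\<close> is the part of \<open>v\<close> orthogonal to the earlier
    vectors. If it vanishes, \<open>Q\<close> already annihilates \<open>v\<close> and is kept
    unchanged.\<close>
  define u where "u i = (\<Sum>j=0..<d. Q i j * v j)" for i
  define N where "N = (\<Sum>i=0..<d. u i * u i)"
  show ?case
  proof (cases "\<forall>i<d. u i = 0")
    case True
    then show ?thesis
      using sym idem null tr unfolding u_def by (intro exI[of _ Q]) auto
  next
    case False
    then have "N > 0"
      unfolding N_def by (auto intro!: sum_pos2 simp: zero_less_mult_iff)
    \<comment> \<open>The subtracted term is the orthogonal projection onto the line of
      \<open>u\<close>, which lies in the range of \<open>Q\<close>.\<close>
    define Q' where "Q' i j = Q i j - u i * u j / N" for i j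
    have Qu: "(\<Sum>k=0..<d. Q i k * u k) = u i" if "i < d" for i
    proof -
      have "(\<Sum>k=0..<d. Q i k * u k) = (\<Sum>k=0..<d. \<Sum>j=0..<d. Q i k * Q k j * v j)"
        unfolding u_def by (simp add: sum_distrib_left mult.assoc)
      also have "\<dots> = (\<Sum>j=0..<d. (\<Sum>k=0..<d. Q i k * Q k j) * v j)"
        by (subst sum.swap) (simp add: sum_distrib_right)
      also have "\<dots> = u i"
        unfolding u_def using that by (intro sum.cong) (auto simp: idem)
      finally show ?thesis .
    qed
    \<comment> \<open>Self-adjointness of \<open>Q\<close> moves it from \<open>v\<close> to
      \<open>w\<close>. Hence \<open>u\<close> is orthogonal to every \<open>w\<close> that
      \<open>Q\<close> annihilates, and pairing \<open>u\<close> with itself is the same as pairing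
      it with \<open>v\<close>.\<close>
    have uw: "(\<Sum>i=0..<d. u i * w i) = (\<Sum>j=0..<d. v j * (\<Sum>i=0..<d. Q j i * w i))" for w
    proof -
      have "(\<Sum>i=0..<d. u i * w i) = (\<Sum>i=0..<d. \<Sum>j=0..<d. v j * (Q j i * w i))"
        unfolding u_def sum_distrib_right by (simp add: sym mult_ac)
      then show ?thesis
        by (subst (asm) sum.swap) (simp add: sum_distrib_left)
    qed
    have uv: "(\<Sum>i=0..<d. u i * v i) = N"
    proof -
      have "N = (\<Sum>j=0..<d. v j * (\<Sum>i=0..<d. Q j i * u i))"
        unfolding N_def by (rule uw)
      also have "\<dots> = (\<Sum>j=0..<d. v j * u j)"
        by (intro sum.cong) (auto simp: Qu)
      finally show ?thesis
        by (simp add: mult.commute)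
    qed
    have Q'w: "(\<Sum>j=0..<d. Q' i j * w j) = (\<Sum>j=0..<d. Q i j * w j) - u i / N * (\<Sum>j=0..<d. u j * w j)"
      for i w
      unfolding Q'_def by (simp add: sum_subtractf sum_distrib_left algebra_simps)
    have "(\<Sum>k=0..<d. Q' i k * Q' k j) = Q' i j" if "i < d" "j < d" for i j
    proof -
      have "(\<Sum>k=0..<d. a k * Q' k j) = (\<Sum>k=0..<d. a k * Q k j) - (\<Sum>k=0..<d. a k * u k) * u j / N"
        for a :: "nat \<Rightarrow> real"
        unfolding Q'_def
        by (simp add: sum_subtractf sum_distrib_left sum_divide_distrib algebra_simps)
      moreover have "(\<Sum>k=0..<d. u k * Q k j) = u j"
        using Qu[OF \<open>j < d\<close>] by (simp add: sym mult.commute)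
      ultimately show ?thesis
        unfolding Q'w using that \<open>N > 0\<close>
        by (simp add: idem Qu N_def[symmetric]) (simp add: Q'_def)
    qed
    moreover have "(\<Sum>j=0..<d. Q' i j * w j) = 0" if "w \<in> set (v # vs)" "i < d" for w i
    proof (cases "w = v")
      case True
      then show ?thesis
        using \<open>N > 0\<close> by (simp add: Q'w uv u_def[symmetric])
    next
      case False
      then show ?thesis
        using that by (simp add: Q'w uw null)
    qed
    moreover have "(\<Sum>i=0..<d. 1 - Q' i i) \<le> length (v # vs)"
    proof -
      have "(\<Sum>i=0..<d. 1 - Q' i i) = (\<Sum>i=0..<d. 1 - Q i i) + N / N"
        by (simp add: Q'_def sum.distrib sum_subtractf flip: sum_divide_distrib N_def)
      then show ?thesis
        using tr \<open>N > 0\<close> by simp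
    qed
    moreover have "Q' i j = Q' j i" for i j
      unfolding Q'_def by (simp add: sym[of i j] mult.commute)
    ultimately show ?thesis
      by (intro exI[of _ Q']) auto
  qed
qed

section \<open>Spectra and Schatten norms of the hard inputs\<close>

definition spiked_mat :: "nat \<Rightarrow> real \<Rightarrow> nat \<Rightarrow> real mat" where
  "spiked_mat d t i = mat d d (\<lambda>(r, c). if r = c then (if r = i then - t else 1) else 0)"

lemma spiked_mat_carrier [simp]: "spiked_mat d t i \<in> carrier_mat d d"
  by (simp add: spiked_mat_def)

lemma real_symmetric_spiked_mat: "real_symmetric d (spiked_mat d t i)"
  unfolding real_symmetric_def by (auto simp: spiked_mat_def)

lemma char_poly_diag:
  fixes f :: "nat \<Rightarrow> real"
  shows "char_poly (mat d d (\<lambda>(r, c). if r = c then f r else 0)) = (\<Prod>r\<leftarrow>[0..<d]. [:- f r, 1:])"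
proof -
  let ?A = "mat d d (\<lambda>(r, c). if r = c then f r else 0)"
  have "char_poly ?A = (\<Prod>a\<leftarrow>diag_mat ?A. [:- a, 1:])"
    by (rule char_poly_upper_triangular[of _ d]) auto
  also have "diag_mat ?A = map f [0..<d]"
    by (auto simp: diag_mat_def)
  finally show ?thesis
    by (simp add: comp_def)
qed

lemma proots_prod_list_linear:
  "proots (\<Prod>r\<leftarrow>xs. [:- f r, 1 :: real:]) = mset (map f xs)"
proof (induction xs)
  case (Cons x xs)
  have "(\<Prod>r\<leftarrow>xs. [:- f r, 1 :: real:]) \<noteq> 0"
    by (auto simp: prod_list_zero_iff)
  then show ?case
    using Cons by (simp add: proots_mult del: mult_pCons_left)
qed simp

lemma lambda_min_spiked_mat:
  assumes "i < d" "t \<ge> 0"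
  shows "lambda_min (spiked_mat d t i) = - t"
proof -
  have "spectrum (spiked_mat d t i) = {x. poly (char_poly (spiked_mat d t i)) x = 0}"
    by (rule spectrum_root_char_poly[OF spiked_mat_carrier])
  also have "\<dots> = (\<lambda>r. if r = i then - t else 1) ` {0..<d}"
    unfolding spiked_mat_def char_poly_diag by (force simp: poly_prod_list prod_list_zero_iff)
  finally show ?thesis
    unfolding lambda_min_def using assms by (intro Min_eqI) auto
qed

lemma singular_values_spiked_mat:
  assumes "i < d" "t \<ge> 0"
  shows "singular_values (spiked_mat d t i) = mset (map (\<lambda>r. if r = i then t else 1) [0..<d])"
proof -
  have "transpose_mat (spiked_mat d t i) * spiked_mat d t i
      = mat d d (\<lambda>(r, c). if r = c then (if r = i then t\<^sup>2 else 1) else 0)"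
    by (rule eq_matI)
       (auto simp: spiked_mat_def scalar_prod_def power2_eq_square if_distrib[of "\<lambda>x. x * _"]
         if_distrib[of "\<lambda>x. _ * x"] sum.If_cases cong: if_cong)
  then have "singular_values (spiked_mat d t i)
      = mset (map (\<lambda>r. sqrt (if r = i then t\<^sup>2 else 1)) [0..<d])"
    unfolding singular_values_def
    by (simp only: char_poly_diag proots_prod_list_linear)
       (simp add: comp_def image_mset.compositionality)
  also have "(\<lambda>r. sqrt (if r = i then t\<^sup>2 else 1)) = (\<lambda>r. if r = i then t else 1)"
    using assms by auto
  finally show ?thesis .
qed

lemma schatten_norm_spiked_mat_infinity:
  assumes "i < d" "t \<ge> 1"
  shows "schatten_norm \<infinity> (spiked_mat d t i) = t"
  using assms unfolding schatten_norm_def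
  by (auto simp: singular_values_spiked_mat intro!: Max_eqI)

lemma schatten_norm_spiked_mat_le:
  assumes "i < d" "t \<ge> 0" "r > 0"
  shows "schatten_norm (ereal r) (spiked_mat d t i) \<le> (t powr r + real d) powr (1 / r)"
proof -
  have "(\<Sum>s\<in>#singular_values (spiked_mat d t i). s powr r)
      = (\<Sum>k=0..<d. (if k = i then t else 1) powr r)"
    using assms
    by (simp add: singular_values_spiked_mat comp_def sum_mset_sum_list interv_sum_list_conv_sum_set_nat
        image_mset.compositionality flip: mset_map)
  \<comment> \<open>Position \<open>i\<close> is charged an extra 1, so that \<open>d - 1\<close>
    becomes \<open>d\<close>, which a power of \<open>t / \<epsilon>\<close> and
    \<open>\<delta>\<close> expresses exactly later.\<close>
  moreover have "(\<Sum>k=0..<d. (if k = i then t else 1) powr r)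
      \<le> (\<Sum>k=0..<d. (if k = i then t powr r else 0) + 1)"
    by (intro sum_mono) auto
  moreover have "\<dots> = t powr r + real d"
    using assms by (simp add: sum.distrib)
  ultimately show ?thesis
    unfolding schatten_norm_def using assms by (auto intro!: powr_mono2 sum_nonneg)
qed

text \<open>For finite \<open>p = r\<close>, the choice of \<open>t\<close> makes \<open>d\<close>
  the \<open>r\<close>-th power of \<open>t * \<delta> / \<epsilon>\<close>. So the norm bound is
  \<open>t / \<epsilon>\<close> times the \<open>r\<close>-norm of the pair
  \<open>(\<epsilon>, \<delta>)\<close>, which is at most 1 because
  \<open>\<epsilon> + \<delta> \<le> 1\<close> and \<open>r \<ge> 1\<close>.\<close>

lemma far_from_psd_spiked_mat:
  assumes "i < d" "1 \<le> p" "0 < \<epsilon>" "0 < \<delta>" "\<epsilon> \<le> 1 - \<delta>"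
    and t: "t = \<epsilon> * real d powr real_of_ereal (1 / p) / \<delta>" "t \<ge> 1"
  shows "far_from_psd d \<epsilon> p (spiked_mat d t i)"
proof -
  have "\<epsilon> * schatten_norm p (spiked_mat d t i) \<le> t"
  proof (cases p)
    case (real r)
    then have r: "r \<ge> 1" and p: "p = ereal r"
      using \<open>1 \<le> p\<close> by (auto simp: one_ereal_def)
    have "1 / p = ereal (1 / r)"
      using r by (simp add: p one_ereal_def)
    then have "t / \<epsilon> = real d powr (1 / r) / \<delta>"
      using t assms by simp
    then have "(t / \<epsilon>) powr r = real d / \<delta> powr r"
      using r assms by (simp add: powr_divide powr_powr)
    then have "real d = (t / \<epsilon>) powr r * \<delta> powr r"
      using assms by simp
    moreover have "t powr r = (t / \<epsilon>) powr r * \<epsilon> powr r"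
      using powr_mult[of "t / \<epsilon>" \<epsilon> r] assms(3) t(2) by simp
    ultimately have "t powr r + real d = (t / \<epsilon>) powr r * (\<epsilon> powr r + \<delta> powr r)"
      by (simp add: distrib_left)
    also have "\<dots> \<le> (t / \<epsilon>) powr r * 1"
    proof (intro mult_left_mono)
      have "\<epsilon> powr r \<le> \<epsilon> powr 1" "\<delta> powr r \<le> \<delta> powr 1"
        using r assms(3-5) by (intro powr_mono'; simp)+
      then show "\<epsilon> powr r + \<delta> powr r \<le> 1"
        using assms by simp
    qed simp
    finally have "(t powr r + real d) powr (1 / r) \<le> ((t / \<epsilon>) powr r) powr (1 / r)"
      using r by (intro powr_mono2) auto
    also have "\<dots> = t / \<epsilon>"
      using r assms by (simp add: powr_powr)
    finally have "schatten_norm p (spiked_mat d t i) \<le> t / \<epsilon>"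
      using schatten_norm_spiked_mat_le[of i d t r] assms r p by simp
    then show ?thesis
      using assms(3) by (simp add: field_simps)
  next
    \<comment> \<open>Since \<open>t \<ge> 1\<close>, the spike is the largest singular value, so
      the norm is \<open>t\<close> itself and \<open>\<epsilon> \<le> 1\<close> suffices.\<close>
    case PInf
    then show ?thesis
      using schatten_norm_spiked_mat_infinity[of i d t] assms(1,3-5) \<open>t \<ge> 1\<close>
      by (simp add: mult_left_le_one_le)
  qed (use assms in auto)
  moreover have "spiked_mat d t i $$ (i, i) \<noteq> 0"
    using assms by (simp add: spiked_mat_def)
  then have "spiked_mat d t i \<noteq> 0\<^sub>m d d"
    using assms by auto
  ultimately show ?thesis
    unfolding far_from_psd_def using assms
    by (simp add: real_symmetric_spiked_mat lambda_min_spiked_mat)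
qed

section \<open>PSD matrices with the same answers as a hard input\<close>

text \<open>Adding a multiple of the rank-one matrix of \<open>n\<close> changes nothing on vectors
  orthogonal to \<open>n\<close>. The negative direction is \<open>e i\<close>. Its part along
  \<open>n\<close> is compensated by the added term, and the remainder \<open>e i - n\<close> is too
  short to outweigh the identity.\<close>

lemma psd_lift_spiked_mat:
  fixes n :: "nat \<Rightarrow> real"
  defines "e \<equiv> \<lambda>i r. if r = i then 1 else (0::real)"
  assumes "i < d" "t \<ge> 0"
    and close: "(1 + t) * (\<Sum>r=0..<d. (e i r - n r)\<^sup>2) < 1"
  obtains B where "psd d B"
    "\<And>v. v \<in> carrier_vec d \<Longrightarrow> (\<Sum>r=0..<d. n r * v $ r) = 0 \<Longrightarrow> B *\<^sub>v v = spiked_mat d t i *\<^sub>v v"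
proof -
  define s where "s = (\<Sum>r=0..<d. (e i r - n r)\<^sup>2)"
  have "s \<ge> 0"
    unfolding s_def by (simp add: sum_nonneg)
  \<comment> \<open>\<open>\<eta>\<close> is the weight for a Young inequality below. The strict
    inequality in \<open>close\<close> leaves room for it: the witness for
    \<open>s \<noteq> 0\<close> turns the second bound into an equality.\<close>
  obtain \<eta> where \<eta>: "\<eta> > 0" "(1 + t) * (1 + \<eta>) * s \<le> 1"
  proof (cases "s = 0")
    case True
    then show ?thesis using that[of 1] by simp
  next
    case False
    then have pos: "(1 + t) * s > 0"
      using \<open>s \<ge> 0\<close> \<open>t \<ge> 0\<close> by simp
    then show ?thesis
      using that[of "1 / ((1 + t) * s) - 1"] close unfolding s_def[symmetric]
      by (simp add: field_simps)
  qed
  \<comment> \<open>\<open>K\<close> is the coefficient that the Young inequality, scaled by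
    \<open>1 + t\<close>, puts on the square of the pairing with \<open>n\<close>, so that the two
    cancel.\<close>
  define K where "K = (1 + t) * (1 + 1 / \<eta>)"
  define B where "B = mat d d (\<lambda>(r, c). spiked_mat d t i $$ (r, c) + K * n r * n c)"
  have Av: "(spiked_mat d t i *\<^sub>v v) $ r = v $ r - (1 + t) * e i r * v $ i"
    if "v \<in> carrier_vec d" "r < d" for v r
    using that
    by (auto simp: spiked_mat_def scalar_prod_def e_def distrib_right
        if_distrib[of "\<lambda>x. x * _"] cong: if_cong)
  have Bv: "(B *\<^sub>v v) $ r = v $ r - (1 + t) * e i r * v $ i + K * n r * (\<Sum>c=0..<d. n c * v $ c)"
    if "v \<in> carrier_vec d" "r < d" for v r
  proof -
    have "(B *\<^sub>v v) $ r = (spiked_mat d t i *\<^sub>v v) $ r + (\<Sum>c=0..<d. K * n r * (n c * v $ c))"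
      using that
      by (simp add: B_def spiked_mat_def scalar_prod_def distrib_right sum.distrib mult.assoc)
    then show ?thesis
      using that by (simp add: Av sum_distrib_left)
  qed
  have "real_symmetric d B"
    unfolding real_symmetric_def B_def by (auto simp: spiked_mat_def)
  moreover have "0 \<le> scalar_prod v (B *\<^sub>v v)" if v: "v \<in> carrier_vec d" for v
  proof -
    define b where "b = (\<Sum>r=0..<d. n r * v $ r)"
    define a where "a = (\<Sum>r=0..<d. (e i r - n r) * v $ r)"
    define m where "m = (\<Sum>r=0..<d. (v $ r)\<^sup>2)"
    have ev: "(\<Sum>r=0..<d. e i r * v $ r) = v $ i"
      using \<open>i < d\<close> by (simp add: e_def if_distrib[of "\<lambda>x. x * _"] cong: if_cong)
    then have ab: "v $ i = a + b"
      unfolding a_def b_def by (simp add: left_diff_distrib sum_subtractf)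
    have "dim_vec (B *\<^sub>v v) = d"
      by (simp add: B_def)
    then have "scalar_prod v (B *\<^sub>v v)
        = (\<Sum>r=0..<d. v $ r * (v $ r - (1 + t) * e i r * v $ i + K * n r * b))"
      unfolding scalar_prod_def b_def using v by (auto simp: Bv intro!: sum.cong simp del: index_mult_mat_vec)
    also have "\<dots> = (\<Sum>r=0..<d. (v $ r)\<^sup>2 - (1 + t) * v $ i * (e i r * v $ r) + K * b * (n r * v $ r))"
      by (intro sum.cong) (auto simp: algebra_simps power2_eq_square)
    also have "\<dots> = m - (1 + t) * v $ i * v $ i + K * b * b"
      by (simp only: sum.distrib sum_subtractf sum_distrib_left[symmetric] ev m_def b_def)
    also have "\<dots> = m - (1 + t) * (a + b)\<^sup>2 + K * b\<^sup>2"
      by (simp add: ab power2_eq_square)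
    finally have eq: "scalar_prod v (B *\<^sub>v v) = m - (1 + t) * (a + b)\<^sup>2 + K * b\<^sup>2" .
    \<comment> \<open>Young's inequality with weight \<open>\<eta>\<close>: the gap is a square
      divided by \<open>\<eta>\<close>.\<close>
    have "(1 + \<eta>) * a\<^sup>2 + (1 + 1 / \<eta>) * b\<^sup>2 - (a + b)\<^sup>2 = (\<eta> * a - b)\<^sup>2 / \<eta>"
      using \<eta> by (simp add: field_simps power2_eq_square)
    then have "(a + b)\<^sup>2 \<le> (1 + \<eta>) * a\<^sup>2 + (1 + 1 / \<eta>) * b\<^sup>2"
      using \<eta> by (smt (verit) divide_nonneg_pos zero_le_power2)
    then have "(1 + t) * (a + b)\<^sup>2 \<le> (1 + t) * ((1 + \<eta>) * a\<^sup>2 + (1 + 1 / \<eta>) * b\<^sup>2)"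
      using \<open>t \<ge> 0\<close> by (intro mult_left_mono) auto
    also have "\<dots> = (1 + t) * (1 + \<eta>) * a\<^sup>2 + K * b\<^sup>2"
      by (simp add: K_def algebra_simps)
    \<comment> \<open>Cauchy-Schwarz bounds the square of \<open>a\<close> by \<open>s * m\<close>;
      the choice of \<open>\<eta>\<close> then leaves at most \<open>m\<close>, the contribution of
      the identity.\<close>
    also have "(1 + t) * (1 + \<eta>) * a\<^sup>2 \<le> (1 + t) * (1 + \<eta>) * (s * m)"
      unfolding a_def s_def m_def using \<open>t \<ge> 0\<close> \<eta>
      by (intro mult_left_mono Cauchy_Schwarz_ineq_sum) auto
    also have "(1 + t) * (1 + \<eta>) * (s * m) \<le> 1 * m"
      using \<eta> mult_right_mono[of "(1 + t) * (1 + \<eta>) * s" 1 m] unfolding m_def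
      by (simp add: sum_nonneg mult.assoc)
    finally show ?thesis
      unfolding eq by simp
  qed
  ultimately have "psd d B"
    unfolding psd_def by blast
  moreover have "B *\<^sub>v v = spiked_mat d t i *\<^sub>v v"
    if "v \<in> carrier_vec d" "(\<Sum>r=0..<d. n r * v $ r) = 0" for v
  proof (rule eq_vecI)
    fix r
    assume "r < dim_vec (spiked_mat d t i *\<^sub>v v)"
    then have "r < d"
      by (simp add: spiked_mat_def)
    then show "(B *\<^sub>v v) $ r = (spiked_mat d t i *\<^sub>v v) $ r"
      using that by (simp add: Av Bv del: index_mult_mat_vec)
  qed (simp add: B_def spiked_mat_def)
  ultimately show ?thesis
    using that by blast
qed

section \<open>Counting rejections and averaging over the coins\<close>

text \<open>Non-adaptivity enters here: the queries are the same for all inputs, so one projection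
  \<open>Q\<close> serves every \<open>i\<close>. A rejected input can have no PSD look-alike, which
  forces its share \<open>1 - Q i i\<close> of the trace defect to be at least
  \<open>1 / (1 + t)\<close>, while all shares add up to at most \<open>q\<close>.\<close>

lemma card_rejected_spiked_mat_le:
  assumes "one_sided d M" "a \<in> space M" "set (fst a) \<subseteq> carrier_vec d" "length (fst a) \<le> q" "t \<ge> 0"
  shows "real (card {i\<in>{0..<d}. \<not> accepts a (spiked_mat d t i)}) \<le> (1 + t) * real q"
proof -
  obtain Q :: "nat \<Rightarrow> nat \<Rightarrow> real"
    where sym: "\<And>i j. Q i j = Q j i"
      and idem: "\<And>i j. i < d \<Longrightarrow> j < d \<Longrightarrow> (\<Sum>k=0..<d. Q i k * Q k j) = Q i j"
      and null: "\<And>v i. v \<in> set (fst a) \<Longrightarrow> i < d \<Longrightarrow> (\<Sum>j=0..<d. Q i j * v $ j) = 0"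
      and tr: "(\<Sum>i=0..<d. 1 - Q i i) \<le> length (fst a)"
    using orthogonal_complement_projection[of d "map vec_index (fst a)"]
    unfolding set_map length_map ball_simps by blast
  \<comment> \<open>Row \<open>i\<close> of \<open>Q\<close> is the projection of the
    \<open>i\<close>-th unit vector. Symmetry and idempotence make its squared length
    \<open>Q i i\<close>.\<close>
  have dist: "(\<Sum>r=0..<d. ((if r = i then 1 else 0) - Q i r)\<^sup>2) = 1 - Q i i" if "i < d" for i
  proof -
    have "(\<Sum>r=0..<d. (Q i r)\<^sup>2) = Q i i"
      using idem[OF that that] by (simp add: power2_eq_square sym)
    moreover have "(\<Sum>r=0..<d. ((if r = i then 1 else 0) - Q i r)\<^sup>2)
        = (\<Sum>r=0..<d. (if r = i then 1 - 2 * Q i i else 0) + (Q i r)\<^sup>2)"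
      by (intro sum.cong) (auto simp: algebra_simps power2_eq_square)
    ultimately show ?thesis
      using that by (simp add: sum.distrib)
  qed
  have nonneg: "1 - Q i i \<ge> 0" if "i < d" for i
    unfolding dist[OF that, symmetric] by (simp add: sum_nonneg)
  have rejected: "1 \<le> (1 + t) * (1 - Q i i)" if "i < d" "\<not> accepts a (spiked_mat d t i)" for i
  proof (rule ccontr)
    assume "\<not> 1 \<le> (1 + t) * (1 - Q i i)"
    then have "(1 + t) * (\<Sum>r=0..<d. ((if r = i then 1 else 0) - Q i r)\<^sup>2) < 1"
      using dist[OF \<open>i < d\<close>] by simp
    then obtain B where B: "psd d B"
      "\<And>v. v \<in> carrier_vec d \<Longrightarrow> (\<Sum>r=0..<d. Q i r * v $ r) = 0 \<Longrightarrow> B *\<^sub>v v = spiked_mat d t i *\<^sub>v v"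
      using psd_lift_spiked_mat[of i d t "Q i"] \<open>i < d\<close> \<open>t \<ge> 0\<close> by blast
    \<comment> \<open>Every query is orthogonal to row \<open>i\<close> of \<open>Q\<close>, so both
      matrices give the same answers.\<close>
    have "map ((*\<^sub>v) B) (fst a) = map ((*\<^sub>v) (spiked_mat d t i)) (fst a)"
      using assms null \<open>i < d\<close> by (intro map_cong refl B(2)) auto
    moreover have "accepts a B"
      using assms B(1) unfolding one_sided_def by blast
    ultimately show False
      using that unfolding accepts_def by metis
  qed
  have "real (card {i\<in>{0..<d}. \<not> accepts a (spiked_mat d t i)})
      \<le> (\<Sum>i\<in>{i\<in>{0..<d}. \<not> accepts a (spiked_mat d t i)}. (1 + t) * (1 - Q i i))"
    unfolding real_of_card using rejected by (intro sum_mono) auto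
  also have "\<dots> \<le> (\<Sum>i=0..<d. (1 + t) * (1 - Q i i))"
    using nonneg \<open>t \<ge> 0\<close> by (intro sum_mono2) auto
  also have "\<dots> \<le> (1 + t) * real q"
    unfolding sum_distrib_left[symmetric] using tr assms by (intro mult_left_mono) auto
  finally show ?thesis .
qed

text \<open>By linearity of expectation the rejection probabilities sum to the expected number of
  rejected inputs, and the count for fixed coins bounds that number pointwise.\<close>

lemma tester_queries_ge:
  assumes "psd_tester d \<epsilon> p q M" "one_sided d M" "t \<ge> 0"
    and far: "\<And>i. i < d \<Longrightarrow> far_from_psd d \<epsilon> p (spiked_mat d t i)"
  shows "2 / 3 * real d \<le> (1 + t) * real q"
proof -
  interpret prob_space M
    using assms unfolding psd_tester_def randomized_alg_def by blast
  define R where "R i = {a\<in>space M. \<not> accepts a (spiked_mat d t i)}" for i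
  have R: "R i \<in> sets M" for i
  proof -
    have "{a\<in>space M. accepts a (spiked_mat d t i)} \<in> sets M"
      using assms real_symmetric_spiked_mat unfolding psd_tester_def randomized_alg_def by blast
    then have "space M - {a\<in>space M. accepts a (spiked_mat d t i)} \<in> sets M"
      by blast
    moreover have "space M - {a\<in>space M. accepts a (spiked_mat d t i)} = R i"
      by (auto simp: R_def)
    ultimately show ?thesis by simp
  qed
  have int: "integrable M (indicat_real (R i))" for i
    using R by (intro integrable_real_indicator) (auto simp: emeasure_eq_measure)
  have "2 / 3 * real d = (\<Sum>i=0..<d. 2 / 3)"
    by simp
  also have "\<dots> \<le> (\<Sum>i=0..<d. prob (R i))"
    using assms(1) far unfolding psd_tester_def R_def by (intro sum_mono) auto
  also have "\<dots> = expectation (\<lambda>a. \<Sum>i=0..<d. indicator (R i) a)"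
    by (subst Bochner_Integration.integral_sum) (use R int in auto)
  also have "\<dots> \<le> expectation (\<lambda>a. (1 + t) * real q)"
  proof (rule integral_mono)
    fix a assume a: "a \<in> space M"
    have "(\<Sum>i=0..<d. indicator (R i) a) = real (card {i\<in>{0..<d}. \<not> accepts a (spiked_mat d t i)})"
      using a by (simp add: R_def indicator_def sum.If_cases Int_def)
    also have "\<dots> \<le> (1 + t) * real q"
      using assms a unfolding psd_tester_def randomized_alg_def
      by (intro card_rejected_spiked_mat_le) auto
    finally show "(\<Sum>i=0..<d. indicator (R i) a) \<le> (1 + t) * real q" .
  qed (use int in auto)
  also have "\<dots> = (1 + t) * real q"
    by (simp add: prob_space)
  finally show ?thesis .
qed

theorem corollary46:
  shows "\<forall>\<delta>::real. 0 < \<delta> \<longrightarrow>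
    (\<exists>c::real. 0 < c \<and>
      (\<forall>(p::ereal) (d::nat) (\<epsilon>::real) (q::nat) (M :: nonadaptive_alg measure).
         1 \<le> p \<longrightarrow> 1 \<le> d \<longrightarrow> 0 < \<epsilon> \<longrightarrow> \<epsilon> < 1 \<longrightarrow>
         \<delta> * real d powr (- real_of_ereal (1 / p)) \<le> \<epsilon> \<longrightarrow> \<epsilon> \<le> 1 - \<delta> \<longrightarrow>
         psd_tester d \<epsilon> p q M \<longrightarrow> one_sided d M \<longrightarrow>
         c * (1 / \<epsilon> * real d powr (1 - real_of_ereal (1 / p))) \<le> real q))"
proof (intro allI impI)
  fix \<delta> :: real
  assume \<delta>: "0 < \<delta>"
  show "\<exists>c::real. 0 < c \<and>
      (\<forall>(p::ereal) (d::nat) (\<epsilon>::real) (q::nat) (M :: nonadaptive_alg measure).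
         1 \<le> p \<longrightarrow> 1 \<le> d \<longrightarrow> 0 < \<epsilon> \<longrightarrow> \<epsilon> < 1 \<longrightarrow>
         \<delta> * real d powr (- real_of_ereal (1 / p)) \<le> \<epsilon> \<longrightarrow> \<epsilon> \<le> 1 - \<delta> \<longrightarrow>
         psd_tester d \<epsilon> p q M \<longrightarrow> one_sided d M \<longrightarrow>
         c * (1 / \<epsilon> * real d powr (1 - real_of_ereal (1 / p))) \<le> real q)"
  \<comment> \<open>The constant comes from
    \<open>2 / 3 * d \<le> (1 + t) * q \<le> 2 * t * q\<close> with
    \<open>t = \<epsilon> * D / \<delta>\<close>.\<close>
  proof (intro exI[of _ "\<delta> / 3"] conjI allI impI)
    fix p :: ereal and d :: nat and \<epsilon> :: real and q :: nat and M :: "nonadaptive_alg measure"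
    assume p: "1 \<le> p" and d: "1 \<le> d" and \<epsilon>: "0 < \<epsilon>" "\<epsilon> \<le> 1 - \<delta>"
      and window: "\<delta> * real d powr (- real_of_ereal (1 / p)) \<le> \<epsilon>"
      and M: "psd_tester d \<epsilon> p q M" "one_sided d M"
    define D where "D = real d powr real_of_ereal (1 / p)"
    define t where "t = \<epsilon> * D / \<delta>"
    have D: "D > 0"
      using d by (simp add: D_def)
    \<comment> \<open>This is the lower end of the window for \<open>\<epsilon>\<close>,
      rewritten.\<close>
    have t: "t \<ge> 1"
      using window D \<delta> by (simp add: t_def D_def powr_minus field_simps)
    have "2 / 3 * real d \<le> (1 + t) * real q"
      using M t p \<epsilon> \<delta>
      by (intro tester_queries_ge far_from_psd_spiked_mat) (auto simp: t_def D_def)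
    also have "\<dots> \<le> 2 * t * real q"
      using t by (intro mult_right_mono) auto
    finally have "real d / (3 * t) \<le> real q"
      using t by (simp add: field_simps)
    moreover have "\<delta> / 3 * (1 / \<epsilon> * real d powr (1 - real_of_ereal (1 / p))) = real d / (3 * t)"
      using d \<delta> \<epsilon> D by (simp add: powr_diff D_def[symmetric] t_def)
    ultimately show "\<delta> / 3 * (1 / \<epsilon> * real d powr (1 - real_of_ereal (1 / p))) \<le> real q"
      by simp
  qed (use \<delta> in simp)
qed

end
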